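(* Let $n\geqslant 2$ and let $X_1,\dots,X_n$ be closed nonzero subspaces of a (real or complex) Banach space $X$ which are linearly independent and whose sum $X_1+\dots+X_n$ is complemented in $X$. Let $\pi:X\to X$ be a (continuous linear) projection onto $X_1+\dots+X_n$ with $\|\pi\|\leqslant C$, where $C>0$, let $V=\ker(\pi)$, and let $\delta_1,\dots,\delta_n>0$ be numbers with $\delta(X_i,\sum_{j\neq i}X_j)\geqslant\delta_i$ for $i=1,\dots,n$. Let $X_1',\dots,X_n'$ be closed nonzero subspaces of $X$ such that for $i=1,\dots,n$ $$\Theta_0(X_i',X_i)<\delta\Big(\sum_{j\neq i}X_j+V,\,X_i\Big)\quad\text{and}\quad \Theta_0(X_i,X_i')<\delta\Big(X_i,\,\sum_{j\neq i}X_j+V\Big),$$ and let $\theta_i,\theta_i'\geqslant 0$ be numbers with $\Theta_0(X_i,X_i')\leqslant\theta_i$ and $\Theta_0(X_i',X_i)\leqslant\theta_i'$, $i=1,\dots,n$. Then for each $i$ the subspaces $X_i'$ and $\sum_{j\neq i}X_j+V$ are complementary to each other in $X$; let $P_i'$ be the projection onto $X_i'$ along $\sum_{j\neq i}X_j+V$. (a) If numbers $a_1,\dots,a_n$ satisfy $\|P_i'\|\leqslant a_i$ for $i=1,\dots,n$ and $$\sum_{i=1}^n\frac{a_i\theta_i'}{a_i\theta_i'+1}<1,$$ then $X_1',\dots,X_n'$ are linearly independent, their sum $X_1'+\dots+X_n'$ is complemented in $X$, and $V$ is a complement of $X_1'+\dots+X_n'$ in $X$ (so $X_1+\dots+X_n$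 and $X_1'+\dots+X_n'$ have the common complement $V$). (b) The conclusion of (a) holds (that is, $X_1',\dots,X_n'$ are linearly independent, their sum is complemented in $X$, and $V$ is a complement of their sum) under each of the following four conditions: (i) $\theta_i<\delta_i/C$ for all $i$ and $\displaystyle\sum_{i=1}^n\frac{(1+\theta_i)\theta_i'}{\delta_i+C((1+\theta_i)\theta_i'-\theta_i)}<\frac1C$; (ii) there are numbers $\lambda_i\geqslant 0$ with $\Lambda_0(X_i,X_i')\leqslant\lambda_i<\delta_i/C$ for all $i$ and $\displaystyle\sum_{i=1}^n\frac{\theta_i'}{\delta_i+C(\theta_i'-\lambda_i)}<\frac1C$; (iii) $\theta_i'<\delta_i/(C+\delta_i)$ for all $i$ and $\displaystyle\sum_{i=1}^n\frac{\theta_i'}{\delta_i(1-\theta_i')}<\frac1C$; (iv) there are numbers $\omega_i'\geqslant 0$ with $\Omega_0(X_i',X_i)\leqslant\omega_i'<\delta_i/C$ for all $i$ and $\displaystyle\sum_{i=1}^n\frac{\theta_i'}{\delta_i-C(\omega_i'-\theta_i')}<\frac1C$.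
   Context: For a closed nonzero subspace $Y$ of $X$, $S_Y=\{y\in Y\mid\|y\|=1\}$ and $B_Y=\{y\in Y\mid\|y\|\leqslant 1\}$; $\mathrm{dist}(x,M)=\inf\{\|x-y\|\mid y\in M\}$. For closed nonzero subspaces $Y,Z$ of $X$: the geometric opening is $\Theta_0(Y,Z)=\sup\{\mathrm{dist}(y,Z)\mid y\in S_Y\}$; the ball opening is $\Lambda_0(Y,Z)=\sup\{\mathrm{dist}(y,B_Z)\mid y\in S_Y\}$; the spherical opening is $\Omega_0(Y,Z)=\sup\{\mathrm{dist}(y,S_Z)\mid y\in S_Y\}$; the inclination of $Y$ to $Z$ is $\delta(Y,Z)=\inf\{\mathrm{dist}(y,Z)\mid y\in S_Y\}$. Subspaces $M,N$ are complementary to each other in $X$ ($N$ is a complement of $M$) if $X$ is the topological direct sum of $M$ and $N$; $M$ is complemented in $X$ if it has a complement, equivalently if there is a continuous linear projection of $X$ onto $M$. Subspaces $X_1,\dots,X_n$ are linearly independent if $x_1+\dots+x_n=0$ with $x_i\in X_i$ implies all $x_i=0$. Under the assumptions, the subspaces $\sum_{j\neq i}X_j$ and $\sum_{j\neq i}X_j+V$ are closed. *)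

theory Defs
  imports "HOL-Analysis.Analysis" "HOL-Library.Set_Algebras"
begin

text \<open>
  Sums of subspaces are Minkowski sums, written with \<open>+\<close> and \<open>\<Sum>\<close> on sets
  (\<open>HOL-Library.Set_Algebras\<close>).

  Real and complex Banach spaces are treated together. The scalar field is a type \<open>'k\<close> of class
  \<^class>\<open>real_normed_field\<close>; its norm is multiplicative, so by the Gelfand-Mazur theorem
  \<open>'k\<close> is \<open>\<real>\<close> or \<open>\<complex>\<close>. The space is a type of class \<^class>\<open>banach\<close> carrying a
  \<open>'k\<close>-scalar multiplication that is compatible with its norm and extends the real scalar
  multiplication.
\<close>

definition normed_space_over ::
  "('k::real_normed_field \<Rightarrow> 'a::real_normed_vector \<Rightarrow> 'a) \<Rightarrow> bool" where
  "normed_space_over smul \<longleftrightarrow>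
     vector_space smul \<and>
     (\<forall>c x. norm (smul c x) = norm c * norm x) \<and>
     (\<forall>r x. smul (of_real r) x = r *\<^sub>R x)"

lemma normed_space_over_real:
  "normed_space_over (scaleR :: real \<Rightarrow> 'a::real_normed_vector \<Rightarrow> 'a)"
  by (simp add: normed_space_over_def real_vector.vector_space_axioms)

lemma normed_space_over_complex:
  "normed_space_over ((*) :: complex \<Rightarrow> complex \<Rightarrow> complex)"
  by (auto simp: normed_space_over_def vector_space_def norm_mult scaleR_conv_of_real
      algebra_simps)

definition closed_nonzero_subspace ::
  "('k::real_normed_field \<Rightarrow> 'a::real_normed_vector \<Rightarrow> 'a) \<Rightarrow> 'a set \<Rightarrow> bool" where
  "closed_nonzero_subspace smul Y \<longleftrightarrow> module.subspace smul Y \<and> closed Y \<and> Y \<noteq> {0}"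

text \<open>
  In the following, \<open>Y \<inter> sphere 0 1\<close> is $S_Y$ and \<open>Y \<inter> cball 0 1\<close> is $B_Y$. For nonzero
  subspaces all index sets are nonempty, all distances are to nonempty sets, and all the families
  are bounded, so that the real-valued suprema and infima are the genuine ones.
\<close>

definition geometric_opening :: "'a::real_normed_vector set \<Rightarrow> 'a set \<Rightarrow> real" where
  "geometric_opening Y Z = (SUP y\<in>Y \<inter> sphere 0 1. infdist y Z)"

definition ball_opening :: "'a::real_normed_vector set \<Rightarrow> 'a set \<Rightarrow> real" where
  "ball_opening Y Z = (SUP y\<in>Y \<inter> sphere 0 1. infdist y (Z \<inter> cball 0 1))"

definition spherical_opening :: "'a::real_normed_vector set \<Rightarrow> 'a set \<Rightarrow> real" where
  "spherical_opening Y Z = (SUP y\<in>Y \<inter> sphere 0 1. infdist y (Z \<inter> sphere 0 1))"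

definition inclination :: "'a::real_normed_vector set \<Rightarrow> 'a set \<Rightarrow> real" where
  "inclination Y Z = (INF y\<in>Y \<inter> sphere 0 1. infdist y Z)"

text \<open>
  The topological direct sum: addition is a homeomorphism from the product of the two subspaces
  onto the whole space.
\<close>

definition complementary ::
  "('k::real_normed_field \<Rightarrow> 'a::real_normed_vector \<Rightarrow> 'a) \<Rightarrow> 'a set \<Rightarrow> 'a set \<Rightarrow> bool" where
  "complementary smul M N \<longleftrightarrow>
     module.subspace smul M \<and> module.subspace smul N \<and>
     (\<exists>g. homeomorphism (M \<times> N) UNIV (\<lambda>(m, n). m + n) g)"

definition complemented ::
  "('k::real_normed_field \<Rightarrow> 'a::real_normed_vector \<Rightarrow> 'a) \<Rightarrow> 'a set \<Rightarrow> bool" where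
  "complemented smul M \<longleftrightarrow> (\<exists>N. complementary smul M N)"

definition continuous_projection_onto ::
  "('k::real_normed_field \<Rightarrow> 'a::real_normed_vector \<Rightarrow> 'a) \<Rightarrow> ('a \<Rightarrow> 'a) \<Rightarrow> 'a set \<Rightarrow> bool" where
  "continuous_projection_onto smul p M \<longleftrightarrow>
     Vector_Spaces.linear smul smul p \<and> continuous_on UNIV p \<and> p \<circ> p = p \<and> range p = M"

text \<open>The projection onto \<open>M\<close> along \<open>N\<close>; meaningful when \<open>M\<close> and \<open>N\<close> are complementary.\<close>

definition projection_along :: "'a::real_normed_vector set \<Rightarrow> 'a set \<Rightarrow> 'a \<Rightarrow> 'a" where
  "projection_along M N x = (THE m. m \<in> M \<and> x - m \<in> N)"

definition independent_subspaces ::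
  "'i set \<Rightarrow> ('i \<Rightarrow> 'a::real_normed_vector set) \<Rightarrow> bool" where
  "independent_subspaces I X \<longleftrightarrow>
     (\<forall>x. (\<forall>i\<in>I. x i \<in> X i) \<and> (\<Sum>i\<in>I. x i) = 0 \<longrightarrow> (\<forall>i\<in>I. x i = 0))"

end

theory Submission
  imports Defs
begin

text \<open>
  Write \<open>W i\<close> for the sum of \<open>V\<close> and all \<open>X j\<close> with \<open>j \<noteq> i\<close>. The projection of the whole space onto
  \<open>X i\<close> along \<open>W i\<close> has norm at most \<open>C / \<delta> i\<close>, because it factors through \<open>p\<close>.

  The opening of \<open>X' i\<close> to \<open>X i\<close> being small makes that projection bounded below on \<open>X' i\<close>, and the
  opening of \<open>X i\<close> to \<open>X' i\<close> being small brings the closed image of \<open>X' i\<close> so close to \<open>X i\<close> that,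
  by F. Riesz's lemma, it cannot be a proper subspace. Hence the projection maps \<open>X' i\<close> isomorphically onto \<open>X i\<close>, which says that \<open>W i\<close> is a
  complement of \<open>X' i\<close> (\<open>bounded_direct_sum_perturb\<close>).

  Let \<open>P i\<close> be the projection onto \<open>X' i\<close> along \<open>W i\<close>. The common kernel of the \<open>P i\<close> is the
  intersection of the \<open>W i\<close>, that is \<open>V\<close>. Let \<open>J\<close> send \<open>(x i)\<close> in the product of the \<open>X' i\<close> to
  \<open>\<Sum>i. x i\<close>, and let \<open>E\<close> send \<open>x\<close> to \<open>(P i x)\<close>. If \<open>E \<circ> J\<close> is invertible, then \<open>J\<close> is injective and every
  vector splits into an element of the range of \<open>J\<close> and one of \<open>V\<close>, which is the conclusion. Now
  \<open>E \<circ> J\<close> is the identity plus a matrix of operators with zero diagonal. Since \<open>P i\<close> kills \<open>X j\<close> for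
  \<open>j \<noteq> i\<close> and elements of \<open>X' j\<close> are close to \<open>X j\<close>, the entry in position \<open>(i, j)\<close> has norm at most
  \<open>a i * \<theta>' j\<close>. The nonnegative matrix with entries \<open>a i * \<theta>' j\<close> off the diagonal is a
  rank one matrix minus a diagonal one, and \<open>(\<Sum>i. a i * \<theta>' i / (a i * \<theta>' i + 1)) < 1\<close> is exactly
  the condition that its spectral radius is less than one: with the weights
  \<open>a i / (1 + a i * \<theta>' i)\<close> the off-diagonal part of \<open>E \<circ> J\<close> is a contraction in the weighted maximum norm, and a Neumann series
  finishes the argument (\<open>components_bounded\<close> and \<open>sum_ranges_cover\<close>).

  Each of the four conditions in the last part yields an explicit bound \<open>a i\<close> on the norm of \<open>P i\<close>
  for which the given sum is the sum above divided by \<open>C\<close>: in the first two, elements of \<open>X i\<close> are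
  approximated by elements of \<open>X' i\<close> (\<open>norm_projection_le_if_summand_approx\<close>), in the last two it
  is the other way round (\<open>norm_projection_le_if_perturbation_approx\<close>).
\<close>

section \<open>Openings, inclination and approximation\<close>

text \<open>The three openings differ only in the set of competitors in \<open>Z\<close>, so one rescaling argument
  serves all of them. The bound \<open>t\<close> has to exceed the opening strictly, since distances to
  subspaces need not be attained.\<close>

lemma opening_approx:
  fixes Y B :: "'a::real_normed_vector set"
  assumes Y: "subspace Y" and B: "B \<noteq> {}"
    and t: "(SUP y\<in>Y \<inter> sphere 0 1. infdist y B) < t"
    and y: "y \<in> Y" "y \<noteq> 0"
  shows "\<exists>b\<in>B. norm (y - norm y *\<^sub>R b) \<le> t * norm y"
proof -
  obtain c where c: "c \<in> B" using B by auto
  let ?u = "(1 / norm y) *\<^sub>R y"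
  have u: "?u \<in> Y \<inter> sphere 0 1"
    using y Y by (simp add: subspace_scale)
  have "infdist x B \<le> 1 + norm c" if "x \<in> Y \<inter> sphere 0 1" for x
    using that norm_triangle_ineq4[of x c]
    by (intro infdist_le2[OF c]) (auto simp: dist_norm)
  then have "bdd_above ((\<lambda>y. infdist y B) ` (Y \<inter> sphere 0 1))"
    by (intro bdd_aboveI2)
  then have "infdist ?u B \<le> (SUP y\<in>Y \<inter> sphere 0 1. infdist y B)"
    by (rule cSUP_upper[OF u])
  then have "(INF b\<in>B. dist ?u b) < t"
    using t B by (simp add: infdist_notempty)
  then obtain b where b: "b \<in> B" "norm (?u - b) < t"
    using B cINF_less_iff[of B "dist ?u" t] bdd_belowI2[of B 0 "dist ?u"]
    by (auto simp: dist_norm)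
  have "y - norm y *\<^sub>R b = norm y *\<^sub>R (?u - b)"
    using y by (simp add: scaleR_diff_right)
  then have "norm (y - norm y *\<^sub>R b) = norm y * norm (?u - b)"
    by simp
  also have "\<dots> \<le> norm y * t"
    using b by (intro mult_left_mono) auto
  finally show ?thesis using b by (auto simp: mult.commute)
qed

lemma geometric_opening_approx:
  fixes Y Z :: "'a::real_normed_vector set"
  assumes "subspace Y" and Z: "subspace Z" and "geometric_opening Y Z < t" "y \<in> Y"
  shows "\<exists>z\<in>Z. norm (y - z) \<le> t * norm y"
proof (cases "y = 0")
  case True
  then show ?thesis using subspace_0[OF Z] by auto
next
  case False
  then obtain b where "b \<in> Z" "norm (y - norm y *\<^sub>R b) \<le> t * norm y"
    using opening_approx[of Y Z t y] assms subspace_0[OF Z]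
    unfolding geometric_opening_def by auto
  then show ?thesis using subspace_scale[OF Z] by blast
qed

lemma ball_opening_approx:
  fixes Y Z :: "'a::real_normed_vector set"
  assumes "subspace Y" and Z: "subspace Z" and "ball_opening Y Z < t" "y \<in> Y"
  shows "\<exists>z\<in>Z. norm z \<le> norm y \<and> norm (y - z) \<le> t * norm y"
proof (cases "y = 0")
  case True
  then show ?thesis using subspace_0[OF Z] by auto
next
  case False
  have "0 \<in> Z \<inter> cball 0 1" using subspace_0[OF Z] by simp
  then obtain b where "b \<in> Z \<inter> cball 0 1" "norm (y - norm y *\<^sub>R b) \<le> t * norm y"
    using opening_approx[of Y "Z \<inter> cball 0 1" t y] assms False
    unfolding ball_opening_def by blast
  then show ?thesis using subspace_scale[OF Z]
    by (intro bexI[of _ "norm y *\<^sub>R b"]) (auto simp: mult_left_le)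
qed

lemma spherical_opening_approx:
  fixes Y Z :: "'a::real_normed_vector set"
  assumes "subspace Y" and Z: "subspace Z" "Z \<noteq> {0}"
    and "spherical_opening Y Z < t" "y \<in> Y"
  shows "\<exists>z\<in>Z. norm z = norm y \<and> norm (y - z) \<le> t * norm y"
proof (cases "y = 0")
  case True
  then show ?thesis using subspace_0[OF Z(1)] by auto
next
  case False
  obtain z where z: "z \<in> Z" "z \<noteq> 0" using Z subspace_0[OF Z(1)] by auto
  then have "(1 / norm z) *\<^sub>R z \<in> Z \<inter> sphere 0 1"
    using subspace_scale[OF Z(1)] by simp
  then obtain b where "b \<in> Z \<inter> sphere 0 1" "norm (y - norm y *\<^sub>R b) \<le> t * norm y"
    using opening_approx[of Y "Z \<inter> sphere 0 1" t y] assms False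
    unfolding spherical_opening_def by blast
  then show ?thesis using subspace_scale[OF Z(1)]
    by (intro bexI[of _ "norm y *\<^sub>R b"]) auto
qed

lemma inclination_mult_norm_le:
  fixes Y Z :: "'a::real_normed_vector set"
  assumes Y: "subspace Y" and Z: "subspace Z" and y: "y \<in> Y" and z: "z \<in> Z"
  shows "inclination Y Z * norm y \<le> norm (y + z)"
proof (cases "y = 0")
  case False
  let ?u = "(1 / norm y) *\<^sub>R y" and ?w = "- ((1 / norm y) *\<^sub>R z)"
  have u: "?u \<in> Y \<inter> sphere 0 1" and w: "?w \<in> Z"
    using False y z Y Z by (simp_all add: subspace_scale subspace_neg)
  have "inclination Y Z \<le> infdist ?u Z"
    unfolding inclination_def
    by (rule cINF_lower[OF _ u]) (auto intro!: bdd_belowI2[where m=0] simp: infdist_nonneg)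
  also have "\<dots> \<le> norm (?u - ?w)"
    using infdist_le[OF w] by (simp add: dist_norm)
  also have "?u - ?w = (1 / norm y) *\<^sub>R (y + z)"
    by (simp add: scaleR_add_right)
  also have "norm \<dots> = norm (y + z) / norm y" by simp
  finally show ?thesis using False by (simp add: field_simps)
qed simp

lemma geometric_opening_nonneg:
  fixes Y Z :: "'a::real_normed_vector set"
  assumes Y: "subspace Y" "Y \<noteq> {0}" and Z: "subspace Z"
  shows "0 \<le> geometric_opening Y Z"
proof (rule ccontr)
  assume "\<not> 0 \<le> geometric_opening Y Z"
  moreover obtain y where y: "y \<in> Y" "y \<noteq> 0" using Y subspace_0[OF Y(1)] by auto
  ultimately obtain z where "norm (y - z) \<le> (geometric_opening Y Z / 2) * norm y"
    using geometric_opening_approx[OF Y(1) Z, of "geometric_opening Y Z / 2" y] by auto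
  moreover have "(geometric_opening Y Z / 2) * norm y < 0"
    using \<open>\<not> 0 \<le> _\<close> y by (simp add: mult_neg_pos)
  ultimately show False using norm_ge_zero[of "y - z"] by linarith
qed

section \<open>Sums of subspaces\<close>

context module
begin

lemma subspace_set_plus:
  assumes A: "subspace A" and B: "subspace B" shows "subspace (A + B)"
proof (rule subspaceI)
  show "0 \<in> A + B" using set_plus_intro[OF subspace_0[OF A] subspace_0[OF B]] by simp
next
  fix x y assume "x \<in> A + B" "y \<in> A + B"
  then obtain a b c d where *: "x = a + b" "y = c + d" "a \<in> A" "c \<in> A" "b \<in> B" "d \<in> B"
    by (auto elim!: set_plus_elim)
  then have "x + y = (a + c) + (b + d)" by (simp add: algebra_simps)
  then show "x + y \<in> A + B"
    using * set_plus_intro[OF subspace_add[OF A] subspace_add[OF B]] by metis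
next
  fix c x assume "x \<in> A + B"
  then obtain a b where "x = a + b" "a \<in> A" "b \<in> B" by (auto elim!: set_plus_elim)
  then show "scale c x \<in> A + B"
    using A B by (auto simp: scale_right_distrib intro!: subspace_scale)
qed

lemma subspace_set_sum:
  assumes "finite I" "\<And>i. i \<in> I \<Longrightarrow> subspace (Y i)" shows "subspace (\<Sum>i\<in>I. Y i)"
  using assms by (induction I rule: finite_induct) (auto simp: set_zero intro!: subspace_set_plus)

end

section \<open>Bounded direct sums and their projections\<close>

text \<open>An algebraic direct sum with a bounded projection. The bound also forces \<open>A\<close> and \<open>W\<close> to meet
  only in \<open>0\<close>. Only real scalars occur: norms, distances and closedness do not see the field
  \<open>'k\<close>.\<close>

definition bounded_direct_sum :: "'a::real_normed_vector set \<Rightarrow> 'a set \<Rightarrow> bool" where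
  "bounded_direct_sum A W \<longleftrightarrow>
     subspace A \<and> subspace W \<and> (\<forall>x. \<exists>a\<in>A. x - a \<in> W) \<and>
     (\<exists>K. \<forall>a\<in>A. \<forall>w\<in>W. norm a \<le> K * norm (a + w))"

context
  fixes A W :: "'a::real_normed_vector set"
  assumes AW: "bounded_direct_sum A W"
begin

lemma bounded_direct_sum_subspaces: "subspace A" "subspace W"
  using AW by (auto simp: bounded_direct_sum_def)

lemma bounded_direct_sum_disjoint:
  assumes "x \<in> A" "x \<in> W" shows "x = 0"
proof -
  have "- x \<in> W" using assms bounded_direct_sum_subspaces by (simp add: subspace_neg)
  moreover obtain K where "\<And>a w. a \<in> A \<Longrightarrow> w \<in> W \<Longrightarrow> norm a \<le> K * norm (a + w)"
    using AW by (auto simp: bounded_direct_sum_def)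
  ultimately have "norm x \<le> K * norm (x + - x)" using assms by blast
  then show ?thesis by simp
qed

lemma projection_along_eqI:
  assumes "a \<in> A" "x - a \<in> W" shows "projection_along A W x = a"
  unfolding projection_along_def
proof (rule the_equality)
  fix m assume m: "m \<in> A \<and> x - m \<in> W"
  then have "m - a \<in> A" "(x - a) - (x - m) \<in> W"
    using assms bounded_direct_sum_subspaces by (blast intro: subspace_diff)+
  then show "m = a" using bounded_direct_sum_disjoint[of "m - a"] by simp
qed (use assms in simp)

lemma projection_along_props:
  "projection_along A W x \<in> A" "x - projection_along A W x \<in> W"
proof -
  obtain a where "a \<in> A" "x - a \<in> W" using AW unfolding bounded_direct_sum_def by blast
  then show "projection_along A W x \<in> A" "x - projection_along A W x \<in> W"
    using projection_along_eqI by auto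
qed

lemma projection_along_add_right:
  assumes "a \<in> A" "w \<in> W" shows "projection_along A W (a + w) = a"
  using assms by (intro projection_along_eqI) auto

lemma projection_along_id: "a \<in> A \<Longrightarrow> projection_along A W a = a"
  using projection_along_add_right[of a 0] subspace_0[OF bounded_direct_sum_subspaces(2)] by simp

lemma projection_along_eq_0_iff: "projection_along A W x = 0 \<longleftrightarrow> x \<in> W"
proof
  assume "projection_along A W x = 0" then show "x \<in> W" using projection_along_props(2)[of x] by simp
next
  assume "x \<in> W" then show "projection_along A W x = 0"
    using projection_along_add_right[of 0 x] subspace_0[OF bounded_direct_sum_subspaces(1)] by simp
qed

lemma bounded_linear_projection_along: "bounded_linear (projection_along A W)"
proof -
  note sub = bounded_direct_sum_subspaces
  let ?P = "projection_along A W"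
  obtain K where K: "\<And>a w. a \<in> A \<Longrightarrow> w \<in> W \<Longrightarrow> norm a \<le> K * norm (a + w)"
    using AW by (auto simp: bounded_direct_sum_def)
  show ?thesis
  proof (rule bounded_linear_intro[where K=K])
    fix x y
    have "x + y - (?P x + ?P y) = (x - ?P x) + (y - ?P y)" by simp
    then have "x + y - (?P x + ?P y) \<in> W"
      using subspace_add[OF sub(2) projection_along_props(2) projection_along_props(2)] by metis
    then show "?P (x + y) = ?P x + ?P y"
      using sub projection_along_props by (intro projection_along_eqI) (auto intro: subspace_add)
  next
    fix r x
    have "r *\<^sub>R x - r *\<^sub>R ?P x = r *\<^sub>R (x - ?P x)" by (simp add: scaleR_diff_right)
    then show "?P (r *\<^sub>R x) = r *\<^sub>R ?P x"
      using sub projection_along_props by (intro projection_along_eqI) (auto intro: subspace_scale)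
  next
    fix x show "norm (?P x) \<le> norm x * K"
      using K[OF projection_along_props[of x]] by (simp add: mult.commute)
  qed
qed

end

lemma bounded_direct_sum_imp_complementary:
  assumes AW: "bounded_direct_sum A W" and "module.subspace smul A" "module.subspace smul W"
  shows "complementary smul A W"
proof -
  let ?P = "projection_along A W"
  interpret P: bounded_linear ?P using AW by (rule bounded_linear_projection_along)
  have "homeomorphism (A \<times> W) UNIV (\<lambda>(m, n). m + n) (\<lambda>x. (?P x, x - ?P x))"
    using projection_along_props[OF AW] projection_along_add_right[OF AW]
    by (intro homeomorphismI)
      (auto intro!: continuous_intros P.continuous_on simp: split_def)
  then show ?thesis using assms unfolding complementary_def by auto
qed

section \<open>Perturbing one summand\<close>

text \<open>F. Riesz's lemma: a proper closed subspace \<open>R\<close> of \<open>A\<close> leaves elements of \<open>A\<close> whose distance to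
  \<open>R\<close> is almost their norm.\<close>

lemma subspace_eq_if_approx:
  fixes A R :: "'a::real_normed_vector set"
  assumes A: "subspace A" and R: "subspace R" "closed R" "R \<subseteq> A" and r: "0 < r" "r < 1"
    and approx: "\<And>a. a \<in> A \<Longrightarrow> \<exists>b\<in>R. norm (a - b) \<le> r * norm a"
  shows "R = A"
proof (rule ccontr)
  assume "R \<noteq> A"
  then obtain a where a: "a \<in> A" "a \<notin> R" using R by auto
  have ne: "R \<noteq> {}" using subspace_0[OF R(1)] by auto
  define d where "d = infdist a R"
  have d: "0 < d" unfolding d_def using infdist_pos_not_in_closed[OF R(2) ne a(2)] .
  then have "(INF b\<in>R. dist a b) < d / r"
    using r ne by (simp add: d_def infdist_notempty pos_less_divide_eq mult_less_cancel_left2)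
  then obtain b where b: "b \<in> R" "norm (a - b) < d / r"
    using ne cINF_less_iff[of R "dist a" "d / r"] bdd_belowI2[of R 0 "dist a"]
    by (auto simp: dist_norm)
  have "a - b \<in> A" using a b R A by (auto intro: subspace_diff)
  then obtain c where c: "c \<in> R" "norm (a - b - c) \<le> r * norm (a - b)" using approx by blast
  have "d \<le> norm (a - (b + c))"
    unfolding d_def using infdist_le[of "b + c" R a] b c R by (simp add: subspace_add dist_norm)
  also have "\<dots> \<le> r * norm (a - b)" using c by (simp add: algebra_simps)
  also have "\<dots> < d" using b r by (simp add: field_simps)
  finally show False by simp
qed

text \<open>The projection \<open>P\<close> onto \<open>A\<close> along \<open>W\<close> has norm at most \<open>1 / inclination A W\<close>, and its
  complementary projection norm at most \<open>1 / inclination W A\<close>. The first hypothesis on the openings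
  makes \<open>a - P a\<close> small for \<open>a\<close> in \<open>A'\<close>, so \<open>P\<close> is bounded below on \<open>A'\<close>; the second one makes the
  closed subspace \<open>P ` A'\<close> all of \<open>A\<close>.\<close>

lemma bounded_direct_sum_perturb:
  fixes A A' W :: "'a::banach set"
  assumes AW: "bounded_direct_sum A W"
    and A': "subspace A'" "closed A'" "A' \<noteq> {0}" and ne: "A \<noteq> {0}"
    and near': "geometric_opening A' A < inclination W A"
    and near: "geometric_opening A A' < inclination A W"
  shows "bounded_direct_sum A' W"
proof -
  define P where "P = projection_along A W"
  interpret P: bounded_linear P unfolding P_def using AW by (rule bounded_linear_projection_along)
  note A = bounded_direct_sum_subspaces(1)[OF AW] and W = bounded_direct_sum_subspaces(2)[OF AW]
  note Pin = projection_along_props[OF AW, folded P_def]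
  define d where "d = inclination A W"
  define e where "e = inclination W A"
  obtain s where s: "geometric_opening A A' < s" "s < d" using near dense unfolding d_def by blast
  obtain t where t: "geometric_opening A' A < t" "t < e" using near' dense unfolding e_def by blast
  have pos: "0 < s" "0 < t"
    using s t geometric_opening_nonneg[OF A ne A'(1)] geometric_opening_nonneg[OF A'(1,3) A] by auto
  then have d: "0 < d" and e: "0 < e" using s t by auto
  have Pd: "d * norm (P x) \<le> norm x" for x
    using inclination_mult_norm_le[OF A W Pin(1)[of x] Pin(2)[of x]] by (simp add: d_def)
  have Pe: "e * norm (x - P x) \<le> norm x" for x
    using inclination_mult_norm_le[OF W A Pin(2)[of x] Pin(1)[of x]] by (simp add: e_def)
  have Pa: "P a = a" if "a \<in> A" for a using projection_along_id[OF AW that] by (simp add: P_def)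
  have lower: "(1 - t / e) * norm a \<le> norm (P a)" if a: "a \<in> A'" for a
  proof -
    obtain b where b: "b \<in> A" "norm (a - b) \<le> t * norm a"
      using geometric_opening_approx[OF A'(1) A t(1) a] by blast
    have "e * norm (a - P a) = e * norm ((a - b) - P (a - b))"
      using Pa[OF b(1)] by (simp add: P.diff)
    also have "\<dots> \<le> t * norm a" using Pe[of "a - b"] b by linarith
    finally have "norm (a - P a) \<le> t / e * norm a" using e by (simp add: field_simps)
    then show ?thesis using norm_triangle_sub[of a "P a"] by (simp add: algebra_simps)
  qed
  have q: "0 < 1 - t / e" using t e by simp
  have surj: "P ` A' = A"
  proof (rule subspace_eq_if_approx[where r = "s / d"])
    show "subspace (P ` A')"
      using A'(1) P.linear_axioms by (intro linear_subspace_image) auto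
    show "closed (P ` A')"
      using complete_isometric_image[OF q A'(1) P.bounded_linear_axioms] lower A'(2)
      by (auto simp: complete_eq_closed)
    fix a assume a: "a \<in> A"
    obtain b where b: "b \<in> A'" "norm (a - b) \<le> s * norm a"
      using geometric_opening_approx[OF A A'(1) s(1) a] by blast
    have "d * norm (a - P b) = d * norm (P (a - b))" using Pa[OF a] by (simp add: P.diff)
    also have "\<dots> \<le> s * norm a" using Pd[of "a - b"] b by linarith
    finally show "\<exists>c\<in>P ` A'. norm (a - c) \<le> s / d * norm a"
      using b d by (auto simp: field_simps)
  qed (use A Pin s d pos in auto)
  show ?thesis
    unfolding bounded_direct_sum_def
  proof (intro conjI allI exI ballI)
    fix x
    obtain a where "a \<in> A'" "P x = P a" using surj Pin by blast
    then show "\<exists>a\<in>A'. x - a \<in> W"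
      using projection_along_eq_0_iff[OF AW, of "x - a"] by (auto simp: P.diff P_def[symmetric])
  next
    fix a w assume a: "a \<in> A'" and w: "w \<in> W"
    have "P w = 0" using w projection_along_eq_0_iff[OF AW] by (simp add: P_def)
    then have "(1 - t / e) * norm a \<le> norm (P (a + w))" using lower[OF a] by (simp add: P.add)
    then have "d * ((1 - t / e) * norm a) \<le> norm (a + w)"
      using Pd[of "a + w"] d mult_left_mono[of _ _ d] by (smt (verit))
    moreover have "0 < d * (1 - t / e)" using d q by simp
    ultimately show "norm a \<le> 1 / (d * (1 - t / e)) * norm (a + w)"
      by (simp add: pos_le_divide_eq mult_ac)
  qed (use A' W in auto)
qed

section \<open>Norm estimates for the perturbed projection\<close>

text \<open>The projection \<open>P'\<close> onto \<open>A'\<close> along \<open>W\<close> factors through the one onto \<open>A\<close> along \<open>W\<close>, so it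
  suffices to bound it on \<open>A\<close>. There \<open>P' a = b + P' (a - b)\<close> for an approximation \<open>b\<close> of \<open>a\<close> in
  \<open>A'\<close>. As \<open>P'\<close> is already known to be bounded, its norm \<open>N\<close> satisfies \<open>d * N \<le> K + t * N\<close>, which
  can be solved for \<open>N\<close>.\<close>

lemma norm_projection_le_if_summand_approx:
  fixes A A' W :: "'a::real_normed_vector set"
  assumes AW: "bounded_direct_sum A W" and A'W: "bounded_direct_sum A' W"
    and d: "\<And>a w. a \<in> A \<Longrightarrow> w \<in> W \<Longrightarrow> d * norm a \<le> norm (a + w)"
    and t: "0 \<le> t" "t < d" and K: "0 \<le> K"
    and approx: "\<And>\<epsilon> a. \<epsilon> > 0 \<Longrightarrow> a \<in> A \<Longrightarrow>
      \<exists>b\<in>A'. norm b \<le> (K + \<epsilon>) * norm a \<and> norm (a - b) \<le> (t + \<epsilon>) * norm a"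
  shows "norm (projection_along A' W x) \<le> K / (d - t) * norm x"
proof -
  define P' where "P' = projection_along A' W"
  interpret P': bounded_linear P' unfolding P'_def using A'W by (rule bounded_linear_projection_along)
  define N where "N = onorm P'"
  have N: "norm (P' x) \<le> N * norm x" for x unfolding N_def by (rule onorm[OF P'.bounded_linear_axioms])
  have N0: "0 \<le> N" unfolding N_def by (rule onorm_pos_le[OF P'.bounded_linear_axioms])
  have d0: "0 < d" using t by simp
  have step: "N \<le> (K + \<epsilon> + N * (t + \<epsilon>)) / d" if \<epsilon>: "\<epsilon> > 0" for \<epsilon>
  proof (rule onorm_bound[of _ P', folded N_def])
    fix x
    define a where "a = projection_along A W x"
    have a: "a \<in> A" "x - a \<in> W" unfolding a_def by (rule projection_along_props[OF AW])+
    obtain b where b: "b \<in> A'" "norm b \<le> (K + \<epsilon>) * norm a" "norm (a - b) \<le> (t + \<epsilon>) * norm a"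
      using approx[OF \<epsilon> a(1)] by blast
    have "P' (x - a) = 0" using a projection_along_eq_0_iff[OF A'W] by (simp add: P'_def)
    then have "P' x = P' a" by (simp add: P'.diff)
    also have "\<dots> = b + P' (a - b)"
      using projection_along_id[OF A'W b(1), folded P'_def] by (simp add: P'.diff)
    finally have "norm (P' x) \<le> norm b + norm (P' (a - b))" using norm_triangle_ineq by metis
    also have "\<dots> \<le> (K + \<epsilon>) * norm a + N * ((t + \<epsilon>) * norm a)"
      using b N[of "a - b"] mult_left_mono[OF b(3) N0] by linarith
    also have "\<dots> = (K + \<epsilon> + N * (t + \<epsilon>)) * norm a" by (simp add: algebra_simps)
    finally have 1: "norm (P' x) \<le> (K + \<epsilon> + N * (t + \<epsilon>)) * norm a" .
    have 2: "norm a \<le> norm x / d" using d[OF a] d0 by (simp add: field_simps)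
    have "0 \<le> K + \<epsilon> + N * (t + \<epsilon>)" using K t N0 \<epsilon> by simp
    then show "norm (P' x) \<le> (K + \<epsilon> + N * (t + \<epsilon>)) / d * norm x"
      using 1 mult_left_mono[OF 2, of "K + \<epsilon> + N * (t + \<epsilon>)"] by simp
  next
    show "0 \<le> (K + \<epsilon> + N * (t + \<epsilon>)) / d" using K t N0 \<epsilon> by simp
  qed
  have "N * d \<le> K + N * t + \<eta>" if "\<eta> > 0" for \<eta>
  proof -
    define \<epsilon> where "\<epsilon> = \<eta> / (1 + N)"
    have "\<epsilon> * (1 + N) = \<eta>" using N0 by (simp add: \<epsilon>_def)
    then have "\<epsilon> + N * \<epsilon> = \<eta>" by (simp add: algebra_simps)
    moreover have "\<epsilon> > 0" using that N0 by (simp add: \<epsilon>_def)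
    ultimately have \<epsilon>: "\<epsilon> > 0" "\<epsilon> + N * \<epsilon> = \<eta>" by auto
    have "N * d \<le> K + \<epsilon> + N * (t + \<epsilon>)"
      using step[OF \<epsilon>(1)] d0 by (simp add: pos_le_divide_eq)
    then show ?thesis using \<epsilon>(2) by (simp add: distrib_left)
  qed
  then have "N * d \<le> K + N * t" by (rule field_le_epsilon)
  then have "N \<le> K / (d - t)" using t by (simp add: field_simps)
  then show ?thesis
    using N[of x] mult_right_mono[of N "K / (d - t)" "norm x"] by (simp add: P'_def)
qed

text \<open>The norm of \<open>P'\<close> is governed by the distance of vectors of \<open>A'\<close> to \<open>W\<close>. For \<open>b\<close> in \<open>A'\<close> it is at
  least the distance of a nearby \<open>a\<close> in \<open>A\<close> to \<open>W\<close> minus the norm of \<open>b - a\<close>.\<close>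

lemma norm_projection_le_if_perturbation_approx:
  fixes A A' W :: "'a::real_normed_vector set"
  assumes A'W: "bounded_direct_sum A' W"
    and d: "\<And>a w. a \<in> A \<Longrightarrow> w \<in> W \<Longrightarrow> d * norm a \<le> norm (a + w)" and d0: "0 < d"
    and pos: "t < d * k"
    and approx: "\<And>\<epsilon> b. \<epsilon> > 0 \<Longrightarrow> b \<in> A' \<Longrightarrow>
      \<exists>a\<in>A. (k - \<epsilon>) * norm b \<le> norm a \<and> norm (b - a) \<le> (t + \<epsilon>) * norm b"
  shows "norm (projection_along A' W x) \<le> 1 / (d * k - t) * norm x"
proof -
  define b where "b = projection_along A' W x"
  have b: "b \<in> A'" "x - b \<in> W" unfolding b_def by (rule projection_along_props[OF A'W])+
  have "d * k * norm b \<le> norm x + t * norm b + \<eta>" if "\<eta> > 0" for \<eta>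
  proof -
    \<comment> \<open>Chosen so that the total error \<open>\<epsilon> * (d + 1) * norm b\<close> stays below \<open>\<eta>\<close>, also for \<open>b = 0\<close>.\<close>
    define \<epsilon> where "\<epsilon> = \<eta> / ((d + 1) * (norm b + 1))"
    have \<epsilon>: "\<epsilon> > 0" unfolding \<epsilon>_def using d0 that by (intro divide_pos_pos mult_pos_pos) (auto simp: add_nonneg_pos)
    have "\<epsilon> * (d + 1) * norm b \<le> \<epsilon> * (d + 1) * (norm b + 1)"
      using \<epsilon> d0 by (intro mult_left_mono) auto
    also have "\<dots> = \<eta>" unfolding \<epsilon>_def using d0 norm_ge_zero[of b]
      by (simp add: add_nonneg_pos less_imp_neq[symmetric] mult.assoc)
    finally have small: "\<epsilon> * (d + 1) * norm b \<le> \<eta>" .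
    obtain a where a: "a \<in> A" "(k - \<epsilon>) * norm b \<le> norm a" "norm (b - a) \<le> (t + \<epsilon>) * norm b"
      using approx[OF \<epsilon> b(1)] by blast
    have "d * ((k - \<epsilon>) * norm b) \<le> d * norm a" using a d0 by (intro mult_left_mono) auto
    also have "\<dots> \<le> norm (a + (x - b))" by (rule d[OF a(1) b(2)])
    also have "\<dots> \<le> norm x + norm (b - a)"
      using norm_triangle_ineq4[of x "b - a"] by (simp add: algebra_simps)
    also have "\<dots> \<le> norm x + (t + \<epsilon>) * norm b" using a by simp
    finally show ?thesis using small by (simp add: algebra_simps)
  qed
  then have "d * k * norm b \<le> norm x + t * norm b" by (rule field_le_epsilon)
  then show ?thesis using pos unfolding b_def[symmetric] by (simp add: field_simps)
qed

section \<open>Projections that almost annihilate the ranges of each other\<close>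

text \<open>The weights solve the eigenvector equation of the matrix with entries \<open>a i * t j\<close> for \<open>i \<noteq> j\<close>
  and zero diagonal, with eigenvalue one in the limiting case \<open>contraction_factor I a t = 1\<close>.\<close>

definition weight :: "('i \<Rightarrow> real) \<Rightarrow> ('i \<Rightarrow> real) \<Rightarrow> 'i \<Rightarrow> real" where
  "weight a t i = a i / (1 + a i * t i)"

definition contraction_factor :: "'i set \<Rightarrow> ('i \<Rightarrow> real) \<Rightarrow> ('i \<Rightarrow> real) \<Rightarrow> real" where
  "contraction_factor I a t = (\<Sum>i\<in>I. t i * weight a t i)"

definition common_kernel :: "'i set \<Rightarrow> ('i \<Rightarrow> 'a \<Rightarrow> 'a::real_normed_vector) \<Rightarrow> 'a set" where
  "common_kernel I P = {x. \<forall>i\<in>I. P i x = 0}"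

context
  fixes I :: "'i set" and Y :: "'i \<Rightarrow> 'a::banach set" and P :: "'i \<Rightarrow> 'a \<Rightarrow> 'a"
    and a t :: "'i \<Rightarrow> real"
  assumes fin: "finite I"
    and Ysub: "\<And>i. i \<in> I \<Longrightarrow> subspace (Y i)" and Yclosed: "\<And>i. i \<in> I \<Longrightarrow> closed (Y i)"
    and lin: "\<And>i. i \<in> I \<Longrightarrow> bounded_linear (P i)"
    and ran: "\<And>i x. i \<in> I \<Longrightarrow> P i x \<in> Y i"
    and idem: "\<And>i y. i \<in> I \<Longrightarrow> y \<in> Y i \<Longrightarrow> P i y = y"
    and a_pos: "\<And>i. i \<in> I \<Longrightarrow> a i > 0" and t_nonneg: "\<And>i. i \<in> I \<Longrightarrow> t i \<ge> 0"
    and P_bound: "\<And>i x. i \<in> I \<Longrightarrow> norm (P i x) \<le> a i * norm x"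
    and P_off: "\<And>i j y. i \<in> I \<Longrightarrow> j \<in> I \<Longrightarrow> i \<noteq> j \<Longrightarrow> y \<in> Y j \<Longrightarrow>
      norm (P i y) \<le> a i * t j * norm y"
    and small: "(\<Sum>i\<in>I. a i * t i / (a i * t i + 1)) < 1"
begin

lemma at_nonneg: "i \<in> I \<Longrightarrow> 0 \<le> a i * t i"
  using a_pos t_nonneg by (simp add: less_imp_le)

lemma weight_pos: "i \<in> I \<Longrightarrow> 0 < weight a t i"
  unfolding weight_def using a_pos at_nonneg by (simp add: add_pos_nonneg)

lemma weight_eq: "i \<in> I \<Longrightarrow> weight a t i * (1 + a i * t i) = a i"
  unfolding weight_def using at_nonneg[of i] by simp

lemma contraction_factor_bounds: "0 \<le> contraction_factor I a t" "contraction_factor I a t < 1"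
proof -
  show "0 \<le> contraction_factor I a t"
    unfolding contraction_factor_def using t_nonneg weight_pos by (intro sum_nonneg) (simp add: less_imp_le)
  show "contraction_factor I a t < 1"
    using small by (simp add: contraction_factor_def weight_def mult_ac add_ac)
qed

text \<open>The contraction estimate for the off-diagonal part. Omitting the diagonal term from the sum
  gives \<open>a i * (\<sigma> - t i * weight a t i)\<close> with \<open>\<sigma>\<close> the contraction factor, and this equals
  \<open>weight a t i * \<sigma> - a i * t i * weight a t i * (1 - \<sigma>)\<close>.\<close>

lemma projection_sum_close:
  assumes y: "\<And>j. j \<in> I \<Longrightarrow> y j \<in> Y j" and m: "0 \<le> m"
    and bound: "\<And>j. j \<in> I \<Longrightarrow> norm (y j) \<le> weight a t j * m" and i: "i \<in> I"
  shows "norm (P i (\<Sum>j\<in>I. y j) - y i) \<le> weight a t i * (contraction_factor I a t * m)"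
proof -
  interpret P: bounded_linear "P i" by (rule lin[OF i])
  have "P i (\<Sum>j\<in>I. y j) = P i (y i) + (\<Sum>j\<in>I - {i}. P i (y j))"
    using fin i by (simp add: sum.remove[OF _ i] P.add P.sum)
  then have "P i (\<Sum>j\<in>I. y j) - y i = (\<Sum>j\<in>I - {i}. P i (y j))"
    using idem[OF i y[OF i]] by simp
  also have "norm \<dots> \<le> (\<Sum>j\<in>I - {i}. a i * m * (t j * weight a t j))"
  proof (rule sum_norm_le)
    fix j assume j: "j \<in> I - {i}"
    have "norm (P i (y j)) \<le> a i * t j * norm (y j)" using j i y by (intro P_off) auto
    also have "\<dots> \<le> a i * t j * (weight a t j * m)"
      using j bound a_pos[OF i] t_nonneg by (intro mult_left_mono) (auto simp: less_imp_le)
    finally show "norm (P i (y j)) \<le> a i * m * (t j * weight a t j)" by (simp add: mult_ac)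
  qed
  also have "\<dots> = a i * m * (contraction_factor I a t - t i * weight a t i)"
    using fin i by (simp add: contraction_factor_def sum_distrib_left[symmetric] sum_diff1)
  also have "\<dots> = weight a t i * (contraction_factor I a t * m)
      - a i * t i * weight a t i * (1 - contraction_factor I a t) * m"
  proof -
    have "a i * contraction_factor I a t * m = weight a t i * (1 + a i * t i) * contraction_factor I a t * m"
      using weight_eq[OF i] by simp
    then show ?thesis by (simp add: algebra_simps)
  qed
  also have "\<dots> \<le> weight a t i * (contraction_factor I a t * m)"
    using at_nonneg[OF i] weight_pos[OF i] contraction_factor_bounds m by simp
  finally show ?thesis .
qed

text \<open>The matrix is bounded below: at an index where the weighted maximum \<open>m\<close> of the \<open>y j\<close> is
  attained, the off-diagonal part cancels at most the fraction given by the contraction factor.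
  The case of vanishing total gives independence, and the general case bounds the projection onto
  the sum.\<close>

lemma components_bounded:
  "\<exists>K. \<forall>y v. (\<forall>j\<in>I. y j \<in> Y j) \<and> v \<in> common_kernel I P \<longrightarrow>
     (\<forall>j\<in>I. norm (y j) \<le> weight a t j * (K * norm ((\<Sum>j\<in>I. y j) + v)))"
proof (intro exI allI impI ballI)
  fix y v j
  assume yv: "(\<forall>j\<in>I. y j \<in> Y j) \<and> v \<in> common_kernel I P" and j: "j \<in> I"
  let ?\<sigma> = "contraction_factor I a t" and ?B = "1 + (\<Sum>i\<in>I. a i * t i)"
  let ?z = "(\<Sum>j\<in>I. y j) + v"
  define m where "m = Max ((\<lambda>i. norm (y i) / weight a t i) ` I)"
  have m_ge: "norm (y i) \<le> weight a t i * m" if "i \<in> I" for i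
  proof -
    have "norm (y i) / weight a t i \<le> m" unfolding m_def using fin that by (intro Max_ge) auto
    then show ?thesis using weight_pos[OF that] by (simp add: field_simps)
  qed
  have m0: "0 \<le> m"
    using order_trans[OF norm_ge_zero m_ge[OF j]] weight_pos[OF j] by (simp add: zero_le_mult_iff)
  have "m \<in> (\<lambda>i. norm (y i) / weight a t i) ` I" unfolding m_def using fin j by (intro Max_in) auto
  then obtain i where i: "i \<in> I" "m = norm (y i) / weight a t i" by auto
  interpret P: bounded_linear "P i" by (rule lin[OF i(1)])
  have w: "weight a t i > 0" by (rule weight_pos[OF i(1)])
  have "norm (y i) \<le> norm (P i (\<Sum>j\<in>I. y j)) + norm (P i (\<Sum>j\<in>I. y j) - y i)"
    using norm_triangle_ineq4[of "P i (\<Sum>j\<in>I. y j)" "P i (\<Sum>j\<in>I. y j) - y i"] by simp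
  also have "\<dots> \<le> norm (P i ?z) + weight a t i * (?\<sigma> * m)"
    using projection_sum_close[of y m i] yv m0 m_ge i(1)
    by (auto simp: P.add common_kernel_def)
  also have "\<dots> \<le> a i * norm ?z + weight a t i * (?\<sigma> * m)" using P_bound[OF i(1), of ?z] by simp
  also have "a i * norm ?z = weight a t i * ((1 + a i * t i) * norm ?z)"
    by (simp only: mult.assoc[symmetric] weight_eq[OF i(1)])
  finally have "weight a t i * m \<le> weight a t i * ((1 + a i * t i) * norm ?z + ?\<sigma> * m)"
    using i(2) w by (simp add: distrib_left)
  then have "m \<le> (1 + a i * t i) * norm ?z + ?\<sigma> * m"
    using w by (rule mult_left_le_imp_le)
  then have "(1 - ?\<sigma>) * m \<le> (1 + a i * t i) * norm ?z" by (simp add: left_diff_distrib)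
  also have "\<dots> \<le> ?B * norm ?z"
    using member_le_sum[OF i(1), of "\<lambda>i. a i * t i"] at_nonneg fin
    by (intro mult_right_mono) auto
  finally have "m \<le> ?B / (1 - ?\<sigma>) * norm ?z"
    using contraction_factor_bounds by (simp add: field_simps)
  then have "weight a t j * m \<le> weight a t j * (?B / (1 - ?\<sigma>) * norm ?z)"
    using weight_pos[OF j] by (intro mult_left_mono) auto
  then show "norm (y j) \<le> weight a t j * (?B / (1 - ?\<sigma>) * norm ?z)"
    using m_ge[OF j] by linarith
qed

lemma independent_ranges: "independent_subspaces I Y"
  unfolding independent_subspaces_def
proof (intro allI impI ballI)
  fix y j assume y: "(\<forall>i\<in>I. y i \<in> Y i) \<and> (\<Sum>i\<in>I. y i) = 0" and j: "j \<in> I"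
  obtain K where K: "\<forall>y v. (\<forall>j\<in>I. y j \<in> Y j) \<and> v \<in> common_kernel I P \<longrightarrow>
     (\<forall>j\<in>I. norm (y j) \<le> weight a t j * (K * norm ((\<Sum>j\<in>I. y j) + v)))"
    using components_bounded by blast
  have "0 \<in> common_kernel I P" by (auto simp: common_kernel_def linear_simps(3)[OF lin])
  then have "norm (y j) \<le> weight a t j * (K * norm ((\<Sum>j\<in>I. y j) + 0))" using K y j by blast
  then show "y j = 0" using y by simp
qed

text \<open>The Neumann series, run in the space itself instead of the product: subtracting from a residual
  \<open>r k\<close> all its projections shrinks the weighted maximum of the \<open>P i (r k)\<close> by the contraction
  factor. The projections removed along the way are summable in each closed \<open>Y i\<close>, and the limit of
  the residuals is killed by every \<open>P i\<close>.\<close>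

lemma sum_ranges_cover:
  "\<exists>y. (\<forall>i\<in>I. y i \<in> Y i) \<and> z - (\<Sum>i\<in>I. y i) \<in> common_kernel I P"
proof -
  let ?\<sigma> = "contraction_factor I a t"
  define r where "r k = ((\<lambda>x. x - (\<Sum>i\<in>I. P i x)) ^^ k) z" for k
  have r_Suc: "r (Suc k) = r k - (\<Sum>i\<in>I. P i (r k))" for k by (simp add: r_def)
  define m where "m = (\<Sum>j\<in>I. norm (P j z) / weight a t j)"
  have m0: "0 \<le> m"
    unfolding m_def using weight_pos by (intro sum_nonneg) (simp add: less_imp_le)
  have decay: "\<forall>i\<in>I. norm (P i (r k)) \<le> weight a t i * (?\<sigma> ^ k * m)" for k
  proof (induction k)
    case 0
    show ?case
    proof
      fix i assume i: "i \<in> I"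
      have "norm (P i z) / weight a t i \<le> m"
        unfolding m_def using member_le_sum[OF i, of "\<lambda>j. norm (P j z) / weight a t j"] fin weight_pos
        by (simp add: less_imp_le)
      then show "norm (P i (r 0)) \<le> weight a t i * (?\<sigma> ^ 0 * m)"
        using weight_pos[OF i] by (simp add: r_def field_simps)
    qed
  next
    case (Suc k)
    show ?case
    proof
      fix i assume i: "i \<in> I"
      interpret P: bounded_linear "P i" by (rule lin[OF i])
      have "norm (P i (\<Sum>j\<in>I. P j (r k)) - P i (r k)) \<le> weight a t i * (?\<sigma> * (?\<sigma> ^ k * m))"
        using Suc.IH ran m0 contraction_factor_bounds i by (intro projection_sum_close) auto
      moreover have "norm (P i (r (Suc k))) = norm (P i (\<Sum>j\<in>I. P j (r k)) - P i (r k))"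
        using norm_minus_commute by (simp add: r_Suc P.diff)
      ultimately show "norm (P i (r (Suc k))) \<le> weight a t i * (?\<sigma> ^ Suc k * m)"
        by (simp add: mult.assoc)
    qed
  qed
  have summ: "summable (\<lambda>k. P i (r k))" if i: "i \<in> I" for i
  proof (rule summable_comparison_test')
    show "summable (\<lambda>k. weight a t i * (?\<sigma> ^ k * m))"
      using contraction_factor_bounds by (intro summable_mult summable_mult2 summable_geometric) simp
  qed (use decay i in auto)
  define y where "y i = (\<Sum>k. P i (r k))" for i
  have lim: "(\<lambda>n. \<Sum>k<n. P i (r k)) \<longlonglongrightarrow> y i" if "i \<in> I" for i
    unfolding y_def by (rule summable_LIMSEQ[OF summ[OF that]])
  have yY: "y i \<in> Y i" if i: "i \<in> I" for i
  proof (rule closed_sequentially[OF Yclosed[OF i] _ lim[OF i]])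
    show "(\<Sum>k<n. P i (r k)) \<in> Y i" for n
      using Ysub[OF i] ran[OF i] by (intro subspace_sum) auto
  qed
  have r_eq: "r n = z - (\<Sum>i\<in>I. \<Sum>k<n. P i (r k))" for n
  proof (induction n)
    case (Suc n)
    have "r (Suc n) = z - (\<Sum>i\<in>I. \<Sum>k<n. P i (r k)) - (\<Sum>i\<in>I. P i (r n))"
      by (subst r_Suc, subst (1) Suc.IH) (rule refl)
    then show ?case by (simp only: sum.lessThan_Suc sum.distrib diff_diff_eq)
  qed (simp add: r_def)
  have rlim: "r \<longlonglongrightarrow> z - (\<Sum>i\<in>I. y i)"
  proof (rule Lim_transform_eventually)
    show "(\<lambda>n. z - (\<Sum>i\<in>I. \<Sum>k<n. P i (r k))) \<longlonglongrightarrow> z - (\<Sum>i\<in>I. y i)"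
      using lim by (intro tendsto_intros)
    show "\<forall>\<^sub>F n in sequentially. z - (\<Sum>i\<in>I. \<Sum>k<n. P i (r k)) = r n"
      using r_eq[symmetric] by (intro always_eventually allI)
  qed
  have "P i (z - (\<Sum>i\<in>I. y i)) = 0" if i: "i \<in> I" for i
    using LIMSEQ_unique[OF bounded_linear.tendsto[OF lin[OF i] rlim] summable_LIMSEQ_zero[OF summ[OF i]]] .
  then show ?thesis using yY by (intro exI[of _ y]) (auto simp: common_kernel_def)
qed

lemma bounded_direct_sum_ranges: "bounded_direct_sum (\<Sum>i\<in>I. Y i) (common_kernel I P)"
  unfolding bounded_direct_sum_def
proof (intro conjI allI)
  obtain K where K: "\<forall>y v. (\<forall>j\<in>I. y j \<in> Y j) \<and> v \<in> common_kernel I P \<longrightarrow>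
     (\<forall>j\<in>I. norm (y j) \<le> weight a t j * (K * norm ((\<Sum>j\<in>I. y j) + v)))"
    using components_bounded by blast
  show "\<exists>K. \<forall>u\<in>\<Sum>i\<in>I. Y i. \<forall>v\<in>common_kernel I P. norm u \<le> K * norm (u + v)"
  proof (intro exI ballI)
    fix u v assume "u \<in> (\<Sum>i\<in>I. Y i)" and v: "v \<in> common_kernel I P"
    then obtain y where y: "\<forall>i\<in>I. y i \<in> Y i" "u = (\<Sum>i\<in>I. y i)"
      by (auto simp: set_sum_alt[OF fin])
    have "norm u \<le> (\<Sum>j\<in>I. weight a t j * (K * norm (u + v)))"
      unfolding y(2) using K y v by (intro sum_norm_le) blast
    then show "norm u \<le> ((\<Sum>j\<in>I. weight a t j) * K) * norm (u + v)"
      by (simp add: sum_distrib_right mult.assoc)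
  qed
  show "\<exists>u\<in>\<Sum>i\<in>I. Y i. x - u \<in> common_kernel I P" for x
    using sum_ranges_cover[of x] by (auto simp: set_sum_alt[OF fin])
  show "subspace (common_kernel I P)"
    unfolding subspace_def common_kernel_def
    by (simp add: linear_simps(1,3,5)[OF lin])
  show "subspace (\<Sum>i\<in>I. Y i)" using fin Ysub by (rule real_vector.subspace_set_sum)
qed
end

section \<open>Complements of the summands\<close>

lemma bounded_linear_if_linear_over:
  fixes smul :: "'k::real_normed_field \<Rightarrow> 'a::real_normed_vector \<Rightarrow> 'a"
  assumes smul: "normed_space_over smul" and lin: "Vector_Spaces.linear smul smul p"
    and cont: "continuous_on UNIV p"
  shows "bounded_linear p"
proof -
  interpret p: Vector_Spaces.linear smul smul p by (rule lin)
  have scale: "smul (of_real r) x = r *\<^sub>R x" for r x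
    using smul by (simp add: normed_space_over_def)
  have p: "linear p"
    using p.add p.scale[of "of_real _"] by (intro linearI) (simp_all add: scale)
  have "isCont p 0" using cont by (simp add: continuous_on_eq_continuous_at)
  then obtain e where e: "e > 0" "\<And>x. norm x < e \<Longrightarrow> norm (p x) < 1"
    using p.zero by (auto simp: continuous_at_eps_delta dest: spec[of _ 1])
  show ?thesis
  proof (rule bounded_linear_intro[where K = "2 / e"])
    fix x show "norm (p x) \<le> norm x * (2 / e)"
    proof (cases "x = 0")
      case False
      have "norm (p ((e / (2 * norm x)) *\<^sub>R x)) < 1"
        using e False by (intro e(2)) simp
      then show ?thesis using e False by (simp add: linear_scale[OF p] field_simps)
    qed (simp add: p.zero)
  qed (use linear_add[OF p] linear_scale[OF p] in auto)
qed

lemma subspace_if_subspace_over: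
  assumes smul: "normed_space_over smul" and Y: "module.subspace smul Y"
  shows "subspace Y"
proof -
  interpret sm: vector_space smul using smul by (simp add: normed_space_over_def)
  have "smul (of_real r) x = r *\<^sub>R x" for r x
    using smul by (simp add: normed_space_over_def)
  then show ?thesis using Y unfolding subspace_def sm.subspace_def by metis
qed

definition co_summand ::
  "'i set \<Rightarrow> ('i \<Rightarrow> 'a::real_normed_vector set) \<Rightarrow> ('a \<Rightarrow> 'a) \<Rightarrow> 'i \<Rightarrow> 'a set" where
  "co_summand I X p i = (\<Sum>j\<in>I - {i}. X j) + {x. p x = 0}"

context
  fixes I :: "'i set" and X :: "'i \<Rightarrow> 'a::real_normed_vector set"
    and p :: "'a \<Rightarrow> 'a" and C :: real and \<delta> :: "'i \<Rightarrow> real"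
  assumes fin: "finite I" and Xsub: "\<And>i. i \<in> I \<Longrightarrow> subspace (X i)"
    and lin: "bounded_linear p" and idem: "\<And>x. p (p x) = p x"
    and ran: "range p = (\<Sum>i\<in>I. X i)"
    and C: "0 < C" "onorm p \<le> C"
    and \<delta>: "\<And>i. i \<in> I \<Longrightarrow> 0 < \<delta> i"
    and incl: "\<And>i. i \<in> I \<Longrightarrow> \<delta> i \<le> inclination (X i) (\<Sum>j\<in>I - {i}. X j)"
begin

interpretation p: bounded_linear p by (rule lin)

lemma subspace_co_summand: "subspace (co_summand I X p i)"
proof -
  have "subspace {x. p x = 0}" by (simp add: subspace_def p.add p.scaleR)
  then show ?thesis unfolding co_summand_def
    using fin Xsub by (intro real_vector.subspace_set_plus real_vector.subspace_set_sum) auto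
qed

lemma p_id_on_sum: "x \<in> (\<Sum>i\<in>I. X i) \<Longrightarrow> p x = x"
  using idem ran by (metis rangeE)

lemma kernel_subset_co_summand: "p x = 0 \<Longrightarrow> x \<in> co_summand I X p i"
proof -
  assume x: "p x = 0"
  have "0 \<in> (\<Sum>j\<in>I - {i}. X j)"
    using fin Xsub by (intro real_vector.subspace_0 real_vector.subspace_set_sum) auto
  then have "0 + x \<in> co_summand I X p i" unfolding co_summand_def using x by (intro set_plus_intro) auto
  then show ?thesis by simp
qed

lemma summand_subset_co_summand:
  assumes "j \<in> I" "j \<noteq> i" "x \<in> X j" shows "x \<in> co_summand I X p i"
proof -
  have "(\<Sum>k\<in>I - {i}. X k) = X j + (\<Sum>k\<in>I - {i} - {j}. X k)"
    using fin assms by (intro sum.remove) auto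
  moreover have "0 \<in> (\<Sum>k\<in>I - {i} - {j}. X k)"
    using fin Xsub by (intro real_vector.subspace_0 real_vector.subspace_set_sum) auto
  ultimately have "x + 0 \<in> (\<Sum>k\<in>I - {i}. X k)"
    using assms(3) by (metis set_plus_intro)
  then have "x + 0 + 0 \<in> co_summand I X p i"
    unfolding co_summand_def by (intro set_plus_intro) (auto simp: p.zero)
  then show ?thesis by simp
qed

text \<open>Applying \<open>p\<close> to \<open>a + w\<close> removes the part of \<open>w\<close> in the kernel at the cost of a factor \<open>C\<close>, and
  what is left is controlled by the inclination.\<close>

lemma summand_norm_le:
  assumes i: "i \<in> I" and a: "a \<in> X i" and w: "w \<in> co_summand I X p i"
  shows "\<delta> i / C * norm a \<le> norm (a + w)"
proof -
  obtain s v where sv: "w = s + v" "s \<in> (\<Sum>j\<in>I - {i}. X j)" "p v = 0"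
    using w unfolding co_summand_def by (auto elim: set_plus_elim)
  have sum: "(\<Sum>j\<in>I. X j) = X i + (\<Sum>j\<in>I - {i}. X j)" using fin i by (rule sum.remove)
  have "p (a + w) = p (a + s) + p v" by (simp add: sv p.add)
  also have "\<dots> = a + s"
  proof -
    have "a + s \<in> (\<Sum>j\<in>I. X j)" unfolding sum using a sv(2) by (rule set_plus_intro)
    then show ?thesis using p_id_on_sum sv(3) by simp
  qed
  finally have eq: "p (a + w) = a + s" .
  have "\<delta> i * norm a \<le> inclination (X i) (\<Sum>j\<in>I - {i}. X j) * norm a"
    using incl[OF i] by (intro mult_right_mono) auto
  also have "\<dots> \<le> norm (a + s)"
    using fin Xsub i a sv by (intro inclination_mult_norm_le real_vector.subspace_set_sum) auto
  also have "\<dots> \<le> onorm p * norm (a + w)" using onorm[OF lin, of "a + w"] eq by simp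
  also have "\<dots> \<le> C * norm (a + w)" using C by (intro mult_right_mono) auto
  finally show ?thesis using C by (simp add: field_simps)
qed

lemma decomposition:
  obtains y where "\<And>i. i \<in> I \<Longrightarrow> y i \<in> X i" "p x = (\<Sum>i\<in>I. y i)"
    "\<And>i. i \<in> I \<Longrightarrow> x - y i \<in> co_summand I X p i"
proof -
  have "p x \<in> (\<Sum>i\<in>I. X i)" using ran by auto
  then obtain y where y: "\<forall>i\<in>I. y i \<in> X i" "p x = (\<Sum>i\<in>I. y i)" by (auto simp: set_sum_alt[OF fin])
  have "x - y i \<in> co_summand I X p i" if i: "i \<in> I" for i
  proof -
    have eq: "x - y i = (\<Sum>j\<in>I - {i}. y j) + (x - p x)"
      using y(2) sum.remove[OF fin i, of y] by simp
    have "(\<Sum>j\<in>I - {i}. y j) \<in> (\<Sum>j\<in>I - {i}. X j)"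
      using fin y by (subst set_sum_alt) auto
    then show ?thesis unfolding co_summand_def eq
      by (rule set_plus_intro) (simp add: p.diff idem)
  qed
  then show thesis using that y by blast
qed

lemma bounded_direct_sum_summand:
  assumes i: "i \<in> I" shows "bounded_direct_sum (X i) (co_summand I X p i)"
  unfolding bounded_direct_sum_def
proof (intro conjI allI exI ballI)
  show "\<exists>a\<in>X i. x - a \<in> co_summand I X p i" for x
    using decomposition[of x] i by metis
  show "norm a \<le> C / \<delta> i * norm (a + w)" if "a \<in> X i" "w \<in> co_summand I X p i" for a w
    using summand_norm_le[OF i that] C \<delta>[OF i] by (simp add: field_simps)
qed (use Xsub i subspace_co_summand in auto)

lemma Inter_co_summand: "{x. \<forall>i\<in>I. x \<in> co_summand I X p i} = {x. p x = 0}"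
proof (intro equalityI subsetI CollectI; elim CollectE)
  fix x assume x: "\<forall>i\<in>I. x \<in> co_summand I X p i"
  obtain y where y: "\<And>i. i \<in> I \<Longrightarrow> y i \<in> X i" "p x = (\<Sum>i\<in>I. y i)"
    "\<And>i. i \<in> I \<Longrightarrow> x - y i \<in> co_summand I X p i" by (rule decomposition[of x]) blast
  have "y i = 0" if i: "i \<in> I" for i
  proof (rule bounded_direct_sum_disjoint[OF bounded_direct_sum_summand[OF i] y(1)[OF i]])
    show "y i \<in> co_summand I X p i"
      using subspace_diff[OF subspace_co_summand _ y(3)[OF i], of x] x i by simp
  qed
  then show "p x = 0" using y(2) by simp
qed (use kernel_subset_co_summand in auto)

end

section \<open>Stability of the sum and of its complement\<close>

lemma le_mult_if_le_mult_greater: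
  fixes x b t :: real
  assumes "0 \<le> b" "\<And>s. t < s \<Longrightarrow> x \<le> s * b"
  shows "x \<le> t * b"
proof (cases "b = 0")
  case True
  then show ?thesis using assms(2)[of "t + 1"] by simp
next
  case False
  then have b: "0 < b" using assms(1) by simp
  have "x / b \<le> t"
  proof (rule dense_ge)
    show "x / b \<le> s" if "t < s" for s
      using assms(2)[OF that] b by (simp add: pos_divide_le_eq)
  qed
  then show ?thesis using b by (simp add: pos_divide_le_eq)
qed

lemma ratio_eq:
  fixes u v \<tau> :: real
  assumes "0 < u" "0 < v" "0 \<le> \<tau>"
  shows "u / v * \<tau> / (u / v * \<tau> + 1) = u * \<tau> / (u * \<tau> + v)"
proof -
  have "u / v * \<tau> + 1 = (u * \<tau> + v) / v" using assms by (simp add: field_simps)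
  then show ?thesis using assms by simp
qed

theorem mainTheorem7:
  fixes smul :: "'k::real_normed_field \<Rightarrow> 'a::banach \<Rightarrow> 'a"
    and n :: nat
    and X X' :: "nat \<Rightarrow> 'a set"
    and V :: "'a set"
    and p :: "'a \<Rightarrow> 'a"
    and C :: real
    and \<delta> \<theta> \<theta>' :: "nat \<Rightarrow> real"
  assumes "normed_space_over smul"
    and "n \<ge> 2"
    and "\<And>i. i \<in> {1..n} \<Longrightarrow> closed_nonzero_subspace smul (X i)"
    and "independent_subspaces {1..n} X"
    and "complemented smul (\<Sum>i\<in>{1..n}. X i)"
    and "continuous_projection_onto smul p (\<Sum>i\<in>{1..n}. X i)"
    and "C > 0" and "onorm p \<le> C"
    and "V = {x. p x = 0}"
    and "\<And>i. i \<in> {1..n} \<Longrightarrow> \<delta> i > 0"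
    and "\<And>i. i \<in> {1..n} \<Longrightarrow> inclination (X i) (\<Sum>j\<in>{1..n} - {i}. X j) \<ge> \<delta> i"
    and "\<And>i. i \<in> {1..n} \<Longrightarrow> closed_nonzero_subspace smul (X' i)"
    and "\<And>i. i \<in> {1..n} \<Longrightarrow>
           geometric_opening (X' i) (X i) < inclination ((\<Sum>j\<in>{1..n} - {i}. X j) + V) (X i)"
    and "\<And>i. i \<in> {1..n} \<Longrightarrow>
           geometric_opening (X i) (X' i) < inclination (X i) ((\<Sum>j\<in>{1..n} - {i}. X j) + V)"
    and "\<And>i. i \<in> {1..n} \<Longrightarrow> \<theta> i \<ge> 0" and "\<And>i. i \<in> {1..n} \<Longrightarrow> \<theta>' i \<ge> 0"
    and "\<And>i. i \<in> {1..n} \<Longrightarrow> geometric_opening (X i) (X' i) \<le> \<theta> i"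
    and "\<And>i. i \<in> {1..n} \<Longrightarrow> geometric_opening (X' i) (X i) \<le> \<theta>' i"
  shows "(\<forall>i\<in>{1..n}. complementary smul (X' i) ((\<Sum>j\<in>{1..n} - {i}. X j) + V)) \<and>
    (\<forall>a :: nat \<Rightarrow> real.
       (\<forall>i\<in>{1..n}. onorm (projection_along (X' i) ((\<Sum>j\<in>{1..n} - {i}. X j) + V)) \<le> a i) \<and>
       (\<Sum>i\<in>{1..n}. a i * \<theta>' i / (a i * \<theta>' i + 1)) < 1 \<longrightarrow>
         independent_subspaces {1..n} X' \<and>
         complemented smul (\<Sum>i\<in>{1..n}. X' i) \<and>
         complementary smul (\<Sum>i\<in>{1..n}. X' i) V) \<and>
    ((\<forall>i\<in>{1..n}. \<theta> i < \<delta> i / C) \<and>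
       (\<Sum>i\<in>{1..n}. (1 + \<theta> i) * \<theta>' i / (\<delta> i + C * ((1 + \<theta> i) * \<theta>' i - \<theta> i))) < 1 / C
     \<or>
     (\<exists>l :: nat \<Rightarrow> real.
       (\<forall>i\<in>{1..n}. l i \<ge> 0 \<and> ball_opening (X i) (X' i) \<le> l i \<and> l i < \<delta> i / C) \<and>
       (\<Sum>i\<in>{1..n}. \<theta>' i / (\<delta> i + C * (\<theta>' i - l i))) < 1 / C)
     \<or>
     (\<forall>i\<in>{1..n}. \<theta>' i < \<delta> i / (C + \<delta> i)) \<and>
       (\<Sum>i\<in>{1..n}. \<theta>' i / (\<delta> i * (1 - \<theta>' i))) < 1 / C
     \<or>
     (\<exists>\<omega>' :: nat \<Rightarrow> real.
       (\<forall>i\<in>{1..n}. \<omega>' i \<ge> 0 \<and> spherical_opening (X' i) (X i) \<le> \<omega>' i \<and> \<omega>' i < \<delta> i / C) \<and>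
       (\<Sum>i\<in>{1..n}. \<theta>' i / (\<delta> i - C * (\<omega>' i - \<theta>' i))) < 1 / C)
     \<longrightarrow>
       independent_subspaces {1..n} X' \<and>
       complemented smul (\<Sum>i\<in>{1..n}. X' i) \<and>
       complementary smul (\<Sum>i\<in>{1..n}. X' i) V)"
proof -
  define I where "I = {1..n}"
  note as = assms[folded I_def]
  note smul = as(1)
  define W where "W i = (\<Sum>j\<in>I - {i}. X j) + V" for i
  define P where "P i = projection_along (X' i) (W i)" for i
  interpret sm: vector_space smul using smul by (simp add: normed_space_over_def)
  have fin: "finite I" by (simp add: I_def)
  have linp: "Vector_Spaces.linear smul smul p" and contp: "continuous_on UNIV p"
    and idem: "p (p x) = p x" and ranp: "range p = (\<Sum>i\<in>I. X i)" for x
    using as(6) by (auto simp: continuous_projection_onto_def fun_eq_iff)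
  have bp: "bounded_linear p" using smul linp contp by (rule bounded_linear_if_linear_over)
  have C0: "0 < C" by (rule as(7))
  have sX: "sm.subspace (X i)" and X: "subspace (X i)" "X i \<noteq> {0}" if "i \<in> I" for i
    using as(3)[OF that] subspace_if_subspace_over[OF smul]
    by (auto simp: closed_nonzero_subspace_def)
  have sX': "sm.subspace (X' i)" and X': "subspace (X' i)" "closed (X' i)" "X' i \<noteq> {0}"
    if "i \<in> I" for i
    using as(12)[OF that] subspace_if_subspace_over[OF smul]
    by (auto simp: closed_nonzero_subspace_def)
  have sV: "sm.subspace V"
    using linp module_hom.subspace_kernel[of smul smul p] as(9)
    by (simp add: module_hom_iff_linear)
  have sW: "sm.subspace (W i)" for i
    unfolding W_def using fin sX sV by (intro sm.subspace_set_plus sm.subspace_set_sum) auto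
  have W_eq: "W i = co_summand I X p i" for i
    by (simp add: W_def co_summand_def as(9))
  note ctx = fin X(1) bp idem ranp C0 as(8) as(10,11)
  have XW: "bounded_direct_sum (X i) (W i)" if "i \<in> I" for i
    using bounded_direct_sum_summand[where \<delta>=\<delta>, OF ctx that] by (simp add: W_eq)
  have dist: "\<delta> i / C * norm a \<le> norm (a + w)" if "i \<in> I" "a \<in> X i" "w \<in> W i" for i a w
    using summand_norm_le[where \<delta>=\<delta>, OF ctx that(1,2)] that(3) by (simp add: W_eq)
  have X'W: "bounded_direct_sum (X' i) (W i)" if i: "i \<in> I" for i
    using bounded_direct_sum_perturb[OF XW[OF i] X'[OF i] X(2)[OF i]] as(13,14)[OF i]
    by (simp add: W_def)
  have compl: "complementary smul (X' i) (W i)" if i: "i \<in> I" for i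
    using X'W[OF i] sX'[OF i] sW by (rule bounded_direct_sum_imp_complementary)
  let ?concl = "independent_subspaces I X' \<and> complemented smul (\<Sum>i\<in>I. X' i) \<and>
      complementary smul (\<Sum>i\<in>I. X' i) V"
  have main: ?concl
    if a: "\<And>i x. i \<in> I \<Longrightarrow> norm (P i x) \<le> a i * norm x"
      and small: "(\<Sum>i\<in>I. a i * \<theta>' i / (a i * \<theta>' i + 1)) < 1" for a
  proof -
    have lin: "bounded_linear (P i)" if "i \<in> I" for i
      unfolding P_def by (rule bounded_linear_projection_along[OF X'W[OF that]])
    have ran: "P i x \<in> X' i" if "i \<in> I" for i x
      unfolding P_def by (rule projection_along_props[OF X'W[OF that]])
    have id: "P i x = x" if "i \<in> I" "x \<in> X' i" for i x
      unfolding P_def using that by (intro projection_along_id[OF X'W])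
    have a_pos: "0 < a i" if i: "i \<in> I" for i
    proof -
      obtain x where x: "x \<in> X' i" "x \<noteq> 0" using X'(1,3)[OF i] subspace_0 by blast
      then have "norm x \<le> a i * norm x" using a[OF i, of x] id[OF i x(1)] by simp
      then show ?thesis using x by simp
    qed
    have off: "norm (P i y) \<le> a i * \<theta>' j * norm y"
      if ij: "i \<in> I" "j \<in> I" "i \<noteq> j" and y: "y \<in> X' j" for i j y
    proof -
      interpret P: bounded_linear "P i" by (rule lin[OF ij(1)])
      have "norm (P i y) \<le> \<theta>' j * (a i * norm y)"
      proof (rule le_mult_if_le_mult_greater)
        show "0 \<le> a i * norm y" using a_pos[OF ij(1)] by simp
        fix s assume "\<theta>' j < s"
        then have "geometric_opening (X' j) (X j) < s" using as(18)[OF ij(2)] by simp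
        then obtain x where x: "x \<in> X j" "norm (y - x) \<le> s * norm y"
          using geometric_opening_approx[OF X'(1) X(1) _ y] ij by blast
        have "x \<in> W i"
          using summand_subset_co_summand[where \<delta>=\<delta>, OF ctx ij(2) ij(3)[symmetric] x(1)]
          by (simp add: W_eq)
        then have "P i x = 0"
          using projection_along_eq_0_iff[OF X'W[OF ij(1)]] by (simp add: P_def)
        then have "norm (P i y) = norm (P i (y - x))" by (simp add: P.diff)
        also have "\<dots> \<le> a i * norm (y - x)" by (rule a[OF ij(1)])
        also have "\<dots> \<le> a i * (s * norm y)"
          using x(2) a_pos[OF ij(1)] by (intro mult_left_mono) auto
        finally show "norm (P i y) \<le> s * (a i * norm y)" by (simp add: mult_ac)
      qed
      then show ?thesis by (simp add: mult_ac)
    qed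
    note sys = fin X'(1,2) lin ran id a_pos as(16) a off small
    have "{x. \<forall>i\<in>I. P i x = 0} = {x. \<forall>i\<in>I. x \<in> W i}"
      using projection_along_eq_0_iff[OF X'W] by (auto simp: P_def)
    also have "\<dots> = V"
      using Inter_co_summand[where \<delta>=\<delta>, OF ctx] by (simp add: W_eq as(9))
    finally have "bounded_direct_sum (\<Sum>i\<in>I. X' i) V"
      using bounded_direct_sum_ranges[OF sys] by (simp add: common_kernel_def)
    then have "complementary smul (\<Sum>i\<in>I. X' i) V"
      using fin sX' sV by (intro bounded_direct_sum_imp_complementary sm.subspace_set_sum) auto
    then show ?concl using independent_ranges[OF sys] by (auto simp: complemented_def)
  qed
  \<comment> \<open>The form in which the four conditions are used: the norm bounds are \<open>a i = u i / v i\<close>, and \<open>f\<close> is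
    the family that is summed in the condition.\<close>
  have main': ?concl
    if uv: "\<And>i. i \<in> I \<Longrightarrow> 0 < u i" "\<And>i. i \<in> I \<Longrightarrow> 0 < v i"
      and P: "\<And>i x. i \<in> I \<Longrightarrow> norm (P i x) \<le> u i / v i * norm x"
      and eq: "\<And>i. i \<in> I \<Longrightarrow> u i * \<theta>' i / (u i * \<theta>' i + v i) = C * f i"
      and f: "(\<Sum>i\<in>I. f i) < 1 / C" for u v f
  proof (rule main[OF P])
    have "u i / v i * \<theta>' i / (u i / v i * \<theta>' i + 1) = C * f i" if "i \<in> I" for i
      using ratio_eq[OF uv as(16), OF that that that] eq[OF that] by (rule trans)
    then have "(\<Sum>i\<in>I. u i / v i * \<theta>' i / (u i / v i * \<theta>' i + 1)) = (\<Sum>i\<in>I. C * f i)"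
      by (rule sum.cong[OF refl])
    also have "\<dots> = C * (\<Sum>i\<in>I. f i)" by (simp add: sum_distrib_left)
    also have "\<dots> < 1" using f C0 by (simp add: field_simps)
    finally show "(\<Sum>i\<in>I. u i / v i * \<theta>' i / (u i / v i * \<theta>' i + 1)) < 1" .
  qed
  have rescale: "q / (q + (d / C - e)) = C * (q / (d + C * (q - e)))" for q d e
  proof -
    have "q + (d / C - e) = (d + C * (q - e)) / C" using C0 by (simp add: field_simps)
    then show ?thesis by simp
  qed
  have d0: "0 < \<delta> i / C" if "i \<in> I" for i using as(10)[OF that] C0 by simp
  have case_i: ?concl
    if "\<forall>i\<in>I. \<theta> i < \<delta> i / C"
      and sum: "(\<Sum>i\<in>I. (1 + \<theta> i) * \<theta>' i / (\<delta> i + C * ((1 + \<theta> i) * \<theta>' i - \<theta> i))) < 1 / C"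
  proof (rule main'[OF _ _ _ rescale sum])
    fix i x assume i: "i \<in> I"
    show "0 < 1 + \<theta> i" using as(15)[OF i] by simp
    show "0 < \<delta> i / C - \<theta> i" using that i by simp
    show "norm (P i x) \<le> (1 + \<theta> i) / (\<delta> i / C - \<theta> i) * norm x"
      unfolding P_def
    proof (rule norm_projection_le_if_summand_approx[OF XW[OF i] X'W[OF i] dist[OF i]])
      fix \<epsilon> :: real and a assume \<epsilon>: "0 < \<epsilon>" and a: "a \<in> X i"
      obtain b where b: "b \<in> X' i" "norm (a - b) \<le> (\<theta> i + \<epsilon>) * norm a"
        using geometric_opening_approx[OF X(1)[OF i] X'(1)[OF i] _ a, of "\<theta> i + \<epsilon>"]
          as(17)[OF i] \<epsilon> by auto
      moreover have "norm b \<le> norm a + norm (a - b)"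
        using norm_triangle_ineq4[of a "a - b"] by simp
      ultimately show "\<exists>b\<in>X' i. norm b \<le> (1 + \<theta> i + \<epsilon>) * norm a \<and>
          norm (a - b) \<le> (\<theta> i + \<epsilon>) * norm a"
        by (intro bexI[of _ b]) (auto simp: distrib_right)
    qed (use that i as(15)[OF i] in auto)
  qed
  have case_ii: ?concl
    if l: "\<forall>i\<in>I. l i \<ge> 0 \<and> ball_opening (X i) (X' i) \<le> l i \<and> l i < \<delta> i / C"
      and sum: "(\<Sum>i\<in>I. \<theta>' i / (\<delta> i + C * (\<theta>' i - l i))) < 1 / C" for l
  proof (rule main'[where u = "\<lambda>_. 1" and v = "\<lambda>i. \<delta> i / C - l i", OF _ _ _ _ sum])
    fix i x assume i: "i \<in> I"
    show "norm (P i x) \<le> 1 / (\<delta> i / C - l i) * norm x"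
      unfolding P_def
    proof (rule norm_projection_le_if_summand_approx[OF XW[OF i] X'W[OF i] dist[OF i]])
      fix \<epsilon> :: real and a assume \<epsilon>: "0 < \<epsilon>" and a: "a \<in> X i"
      obtain b where b: "b \<in> X' i" "norm b \<le> norm a" "norm (a - b) \<le> (l i + \<epsilon>) * norm a"
        using ball_opening_approx[OF X(1)[OF i] X'(1)[OF i] _ a, of "l i + \<epsilon>"] l i \<epsilon> by force
      moreover have "norm a \<le> (1 + \<epsilon>) * norm a" using \<epsilon> by (simp add: distrib_right)
      ultimately show "\<exists>b\<in>X' i. norm b \<le> (1 + \<epsilon>) * norm a \<and>
          norm (a - b) \<le> (l i + \<epsilon>) * norm a"
        by (intro bexI[of _ b]) auto
    qed (use l i in auto)
    show "1 * \<theta>' i / (1 * \<theta>' i + (\<delta> i / C - l i)) = C * (\<theta>' i / (\<delta> i + C * (\<theta>' i - l i)))"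
      by (simp only: mult_1 rescale)
  qed (use l in auto)
  have case_iii: ?concl
    if t: "\<forall>i\<in>I. \<theta>' i < \<delta> i / (C + \<delta> i)"
      and sum: "(\<Sum>i\<in>I. \<theta>' i / (\<delta> i * (1 - \<theta>' i))) < 1 / C"
  proof (rule main'[where u = "\<lambda>_. 1" and v = "\<lambda>i. \<delta> i / C * (1 - \<theta>' i) - \<theta>' i", OF _ _ _ _ sum])
    fix i x assume i: "i \<in> I"
    have "\<theta>' i < \<delta> i / (C + \<delta> i)" using t i by blast
    moreover have "0 < C + \<delta> i" using as(10)[OF i] C0 by simp
    ultimately have "\<theta>' i * (C + \<delta> i) < \<delta> i" by (simp only: pos_less_divide_eq)
    then have pos: "\<theta>' i < \<delta> i / C * (1 - \<theta>' i)" using C0 by (simp add: field_simps)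
    then show "0 < \<delta> i / C * (1 - \<theta>' i) - \<theta>' i" by simp
    show "norm (P i x) \<le> 1 / (\<delta> i / C * (1 - \<theta>' i) - \<theta>' i) * norm x"
      unfolding P_def
    proof (rule norm_projection_le_if_perturbation_approx[OF X'W[OF i] dist[OF i] d0[OF i] pos])
      fix \<epsilon> :: real and b assume \<epsilon>: "0 < \<epsilon>" and b: "b \<in> X' i"
      obtain a where a: "a \<in> X i" "norm (b - a) \<le> (\<theta>' i + \<epsilon>) * norm b"
        using geometric_opening_approx[OF X'(1)[OF i] X(1)[OF i] _ b, of "\<theta>' i + \<epsilon>"]
          as(18)[OF i] \<epsilon> by auto
      moreover have "norm b \<le> norm a + norm (b - a)"
        using norm_triangle_ineq[of a "b - a"] by simp
      ultimately show "\<exists>a\<in>X i. (1 - \<theta>' i - \<epsilon>) * norm b \<le> norm a \<and>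
          norm (b - a) \<le> (\<theta>' i + \<epsilon>) * norm b"
        by (intro bexI[of _ a]) (auto simp: algebra_simps)
    qed
    show "1 * \<theta>' i / (1 * \<theta>' i + (\<delta> i / C * (1 - \<theta>' i) - \<theta>' i)) = C * (\<theta>' i / (\<delta> i * (1 - \<theta>' i)))"
      by simp
  qed auto
  have case_iv: ?concl
    if o: "\<forall>i\<in>I. \<omega>' i \<ge> 0 \<and> spherical_opening (X' i) (X i) \<le> \<omega>' i \<and> \<omega>' i < \<delta> i / C"
      and sum: "(\<Sum>i\<in>I. \<theta>' i / (\<delta> i - C * (\<omega>' i - \<theta>' i))) < 1 / C" for \<omega>'
  proof (rule main'[where u = "\<lambda>_. 1" and v = "\<lambda>i. \<delta> i / C - \<omega>' i", OF _ _ _ _ sum])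
    fix i x assume i: "i \<in> I"
    have pos: "\<omega>' i < \<delta> i / C * 1" using o i by simp
    show "norm (P i x) \<le> 1 / (\<delta> i / C - \<omega>' i) * norm x"
      unfolding P_def
    proof (rule norm_projection_le_if_perturbation_approx[OF X'W[OF i] dist[OF i] d0[OF i] pos, unfolded mult_1_right])
      fix \<epsilon> :: real and b assume \<epsilon>: "0 < \<epsilon>" and b: "b \<in> X' i"
      obtain a where a: "a \<in> X i" "norm a = norm b" "norm (b - a) \<le> (\<omega>' i + \<epsilon>) * norm b"
        using spherical_opening_approx[OF X'(1)[OF i] X[OF i] _ b, of "\<omega>' i + \<epsilon>"] o i \<epsilon> by force
      then show "\<exists>a\<in>X i. (1 - \<epsilon>) * norm b \<le> norm a \<and>
          norm (b - a) \<le> (\<omega>' i + \<epsilon>) * norm b"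
        using \<epsilon> by (intro bexI[of _ a]) (auto simp: left_diff_distrib)
    qed
    have "\<delta> i + C * (\<theta>' i - \<omega>' i) = \<delta> i - C * (\<omega>' i - \<theta>' i)" by (simp add: algebra_simps)
    then show "1 * \<theta>' i / (1 * \<theta>' i + (\<delta> i / C - \<omega>' i)) = C * (\<theta>' i / (\<delta> i - C * (\<omega>' i - \<theta>' i)))"
      using rescale[of "\<theta>' i" "\<delta> i" "\<omega>' i"] by simp
  qed (use o in auto)
  have case_a: ?concl
    if a: "\<forall>i\<in>I. onorm (P i) \<le> a i"
      and small: "(\<Sum>i\<in>I. a i * \<theta>' i / (a i * \<theta>' i + 1)) < 1" for a
  proof (rule main[OF _ small])
    fix i x assume i: "i \<in> I"
    have "norm (P i x) \<le> onorm (P i) * norm x"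
      unfolding P_def by (rule onorm[OF bounded_linear_projection_along[OF X'W[OF i]]])
    also have "\<dots> \<le> a i * norm x" using a i by (intro mult_right_mono) auto
    finally show "norm (P i x) \<le> a i * norm x" .
  qed
  show ?thesis
    unfolding I_def[symmetric] W_def[symmetric] P_def[symmetric]
    using compl case_a case_i case_ii case_iii case_iv by blast
qed

end
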